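(* Let $\mathcal{A}$ be a torsion free Abelian group and $a_1,\dots,a_n\in\mathcal{A}$. A function $f:\mathcal{A}\to\mathbb{R}$ decomposes into a sum $f=f_1+\cdots+f_n$ of functions $f_j:\mathcal{A}\to\mathbb{R}$ with $f_j$ being $a_j$-periodic for each $j=1,\dots,n$, if and only if for all partitions $B_1\cup B_2\cup\cdots\cup B_N=\{a_1,\dots,a_n\}$, with $b_j$ denoting the least common multiple of the elements in $B_j$ ($j=1,\dots,N$), one has $$\Delta_{b_1}\cdots\Delta_{b_N}f=0.$$
   Context: The group $\mathcal{A}$ is written additively. For $a\in\mathcal{A}$ and a function $f$ on $\mathcal{A}$, $\Delta_a f(x):=f(x+a)-f(x)$; $f$ is $a$-periodic if $\Delta_a f=0$. In a torsion free Abelian group, the least common multiple of elements $c_1,\dots,c_m$ is the generator, unique up to taking the inverse, of the cyclic group $\langle c_1\rangle\cap\cdots\cap\langle c_m\rangle$, where $\langle c\rangle$ denotes the cyclic subgroup generated by $c$; it may be $0$ (e.g. the least common multiple of $1$ and $\sqrt2$ in $(\mathbb{R},+)$ is $0$). Either choice of the generator may be used. Partitions are partitions of the set $\{a_1,\dots,a_n\}$ into nonempty blocks. *)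

theory Defs
  imports Complex_Main "HOL-Library.Disjoint_Sets" "HOL-Computational_Algebra.Group_Closure"
begin

definition Delta :: "'a::ab_group_add \<Rightarrow> ('a \<Rightarrow> real) \<Rightarrow> 'a \<Rightarrow> real" where
  "Delta a f = (\<lambda>x. f (x + a) - f x)"

definition periodic :: "'a::ab_group_add \<Rightarrow> ('a \<Rightarrow> real) \<Rightarrow> bool" where
  "periodic a f \<longleftrightarrow> Delta a f = (\<lambda>_. 0)"

(* There is no multiplication by integers on class ab_group_add; the k-fold multiple of x is
   written as the sum of k copies of x. *)
definition torsion_free :: "'a::ab_group_add itself \<Rightarrow> bool" where
  "torsion_free _ \<longleftrightarrow> (\<forall>(x::'a) k::nat. k > 0 \<longrightarrow> (\<Sum>i<k. x) = 0 \<longrightarrow> x = 0)"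

(* A relation rather than a function, since the generator is unique only up to sign.  For
   nonempty B, is_lcm_exists and is_lcm_unique below give existence and uniqueness up to sign. *)
definition is_lcm :: "'a::ab_group_add set \<Rightarrow> 'a \<Rightarrow> bool" where
  "is_lcm B b \<longleftrightarrow> group_closure {b} = (\<Inter>c\<in>B. group_closure {c})"

definition zmul :: "int \<Rightarrow> 'a::ab_group_add \<Rightarrow> 'a" where
  "zmul k x = (\<Sum>i<nat k. x) - (\<Sum>i<nat (- k). x)"

lemma zmul_0 [simp]: "zmul 0 x = 0"
  and zmul_1 [simp]: "zmul 1 x = x"
  by (simp_all add: zmul_def)

lemma zmul_Suc: "zmul (k + 1) x = zmul k x + x"
proof (cases "k \<ge> 0")
  case True
  then have "nat (k + 1) = Suc (nat k)" by simp
  with True show ?thesis by (simp add: zmul_def)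
next
  case False
  then have "nat (- k) = Suc (nat (- (k + 1)))" by simp
  with False show ?thesis by (simp add: zmul_def)
qed

lemma zmul_add: "zmul (k + l) x = zmul k x + zmul l x"
proof (induction l rule: int_induct[where k = 0])
  case (step1 i)
  then show ?case using zmul_Suc[of "k + i" x] zmul_Suc[of i x] by (simp add: add.assoc)
next
  case (step2 i)
  then show ?case using zmul_Suc[of "k + i - 1" x] zmul_Suc[of "i - 1" x]
    by (simp add: algebra_simps)
qed simp

lemma zmul_diff: "zmul (k - l) x = zmul k x - zmul l x"
  using zmul_add[of "k - l" l x] by (simp add: algebra_simps)

lemma zmul_minus: "zmul (- k) x = - zmul k x"
  using zmul_diff[of 0 k x] by simp

lemma zmul_mult: "zmul (k * l) x = zmul k (zmul l x)"
proof (induction k rule: int_induct[where k = 0])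
  case (step1 i)
  then show ?case by (simp add: distrib_right zmul_add)
next
  case (step2 i)
  then show ?case by (simp add: left_diff_distrib zmul_diff)
qed simp

lemma group_closure_single: "group_closure {x} = range (\<lambda>k. zmul k x)"
proof (rule subset_antisym)
  show "group_closure {x} \<subseteq> range (\<lambda>k. zmul k x)"
  proof
    fix y assume "y \<in> group_closure {x}"
    then show "y \<in> range (\<lambda>k. zmul k x)"
    proof induction
      case (base s)
      then show ?case by (metis insert_iff empty_iff rangeI zmul_0 zmul_1)
    next
      case (diff s t)
      then obtain k l where "s = zmul k x" "t = zmul l x" by auto
      then have "s - t = zmul (k - l) x" by (simp add: zmul_diff)
      then show ?case by blast
    qed
  qed
  have "zmul k x \<in> group_closure {x}" for k
  proof (induction k rule: int_induct[where k = 0])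
    case (step1 i)
    then show ?case by (simp add: zmul_Suc group_closure_add group_closure.base)
  next
    case (step2 i)
    then show ?case by (simp add: zmul_diff group_closure.diff group_closure.base)
  qed simp
  then show "range (\<lambda>k. zmul k x) \<subseteq> group_closure {x}" by auto
qed

lemma is_lcm_exists:
  assumes "B \<noteq> {}"
  shows "\<exists>b. is_lcm B b"
proof -
  obtain c where c: "c \<in> B" using assms by auto
  define H where "H = (\<Inter>c\<in>B. group_closure {c})"
  define I where "I = {k. zmul k c \<in> H}"
  have H0: "0 \<in> H" by (simp add: H_def)
  have Hd: "s - t \<in> H" if "s \<in> H" "t \<in> H" for s t
    using that by (auto simp: H_def intro: group_closure.diff)
  have "k \<in> I" if "k \<in> group_closure I" for k
    using that H0 Hd by induction (auto simp: I_def zmul_diff)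
  then have "group_closure I = I" by (auto intro: group_closure.base)
  then have I: "I = range (times (Gcd I))" using group_closure_eq[of I] by simp
  have "H \<subseteq> group_closure {c}" using c by (auto simp: H_def)
  then have "H = (\<lambda>k. zmul k c) ` I" by (auto simp: I_def group_closure_single)
  also have "\<dots> = range (\<lambda>k. zmul (Gcd I * k) c)" by (subst I) (simp add: image_image)
  also have "\<dots> = group_closure {zmul (Gcd I) c}"
    by (simp add: group_closure_single zmul_mult[symmetric] mult.commute)
  finally show ?thesis unfolding is_lcm_def H_def by metis
qed

lemma is_lcm_unique:
  fixes b b' :: "'a::ab_group_add"
  assumes "torsion_free TYPE('a)" "is_lcm B b" "is_lcm B b'"
  shows "b' = b \<or> b' = - b"
proof -
  have tf: "x = 0" if "zmul k x = 0" "k \<noteq> 0" for k and x :: 'a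
  proof (cases "k > 0")
    case True
    then have "(\<Sum>i<nat k. x) = 0" "nat k > 0" using that by (simp_all add: zmul_def)
    then show ?thesis using assms(1) unfolding torsion_free_def by blast
  next
    case False
    then have "(\<Sum>i<nat (- k). x) = 0" "nat (- k) > 0" using that by (simp_all add: zmul_def)
    then show ?thesis using assms(1) unfolding torsion_free_def by blast
  qed
  have eq: "group_closure {b} = group_closure {b'}"
    using assms(2,3) by (simp add: is_lcm_def)
  then have "b' \<in> group_closure {b}" by (simp add: group_closure.base)
  then obtain k where k: "b' = zmul k b" by (auto simp: group_closure_single)
  have "b \<in> group_closure {b'}" using eq[symmetric] by (simp add: group_closure.base)
  then obtain l where l: "b = zmul l b'" by (auto simp: group_closure_single)
  have "zmul (l * k - 1) b = 0" using k l by (simp add: zmul_diff zmul_mult)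
  then consider "b = 0" | "l * k = 1" using tf by fastforce
  then show ?thesis
  proof cases
    case 1
    then show ?thesis using k zmul_mult[of k 0 b] by simp
  next
    case 2
    then have "k = 1 \<or> k = - 1" by (metis mult.commute zmult_eq_1_iff)
    then show ?thesis using k by (auto simp: zmul_minus)
  qed
qed

end

theory Submission
  imports Defs
begin

text \<open>
  Induction on the set \<open>S\<close> of periods. If \<open>0 \<in> S\<close> there is nothing to do. Otherwise let \<open>C\<close> be the
  set of all elements of \<open>S\<close> commensurable with some fixed \<open>s \<in> S\<close>, let \<open>b \<noteq> 0\<close> be its least common
  multiple and \<open>S' = S - C\<close>. Partitions of \<open>S\<close> having \<open>C\<close> as a block show that \<open>\<Delta>\<^sub>b f\<close> satisfies the
  condition for \<open>S'\<close>, so \<open>\<Delta>\<^sub>b f\<close> is a sum of \<open>c\<close>-periodic functions \<open>h\<^sub>c\<close>, \<open>c \<in> S'\<close>. As \<open>b\<close> has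
  infinite order modulo \<open>c\<close>, each \<open>h\<^sub>c\<close> is \<open>\<Delta>\<^sub>b g\<^sub>c\<close> with \<open>g\<^sub>c\<close> again \<open>c\<close>-periodic; subtracting the
  \<open>g\<^sub>c\<close> makes \<open>f\<close> \<open>b\<close>-periodic. On \<open>b\<close>-periodic functions the averages \<open>P\<^sub>c\<close> over the finite
  \<open>c\<close>-orbits are defined for \<open>c \<in> C\<close>, and \<open>f\<close> differs from \<open>(\<Prod>c\<in>C. 1 - P\<^sub>c) f\<close> by a sum of
  \<open>c\<close>-periodic functions, \<open>c \<in> C\<close>. Since \<open>1 - P\<^sub>c\<close> kills whatever \<open>\<Delta>\<^sub>c\<close> kills, partitions of \<open>S\<close>
  in which each \<open>c \<in> C\<close> is a block of its own show that this remainder satisfies the condition for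
  \<open>S'\<close>.
\<close>

section \<open>Difference operators and periodic functions\<close>

lemma Delta_diff: "Delta a (\<lambda>x. f x - g x) = (\<lambda>x. Delta a f x - Delta a g x)"
  by (auto simp: Delta_def)

lemma Delta_sum: "Delta a (\<lambda>x. \<Sum>i\<in>I. g i x) = (\<lambda>x. \<Sum>i\<in>I. Delta a (g i) x)"
  by (auto simp: Delta_def sum_subtractf)

lemma Delta_const [simp]: "Delta a (\<lambda>_. c) = (\<lambda>_. 0)"
  by (auto simp: Delta_def)

lemma Delta_commute: "Delta a (Delta b f) = Delta b (Delta a f)"
  by (auto simp: Delta_def add.assoc add.commute add.left_commute)

lemma foldr_Delta_diff:
  "foldr Delta bs (\<lambda>x. f x - g x) = (\<lambda>x. foldr Delta bs f x - foldr Delta bs g x)"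
  by (induction bs) (simp_all add: Delta_diff)

lemma foldr_Delta_sum:
  "foldr Delta bs (\<lambda>x. \<Sum>i\<in>I. g i x) = (\<lambda>x. \<Sum>i\<in>I. foldr Delta bs (g i) x)"
  by (induction bs) (simp_all add: Delta_sum)

lemma foldr_Delta_zero [simp]: "foldr Delta bs (\<lambda>_. 0) = (\<lambda>_. 0)"
  by (induction bs) simp_all

lemma foldr_Delta_commute: "foldr Delta bs (Delta a f) = Delta a (foldr Delta bs f)"
  by (induction bs) (simp_all add: Delta_commute)

text \<open>The operators commute, so the factor for \<open>b\<close> can be moved next to
  \<open>f\<close>.\<close>

lemma foldr_Delta_periodic:
  assumes "b \<in> set bs" "periodic b f"
  shows "foldr Delta bs f = (\<lambda>_. 0)"
  using assms(1)
proof (induction bs)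
  case (Cons d bs)
  show ?case
  proof (cases "b = d")
    case True
    then have "foldr Delta (d # bs) f = foldr Delta bs (Delta b f)"
      by (simp add: foldr_Delta_commute)
    then show ?thesis using assms(2) by (simp add: periodic_def)
  next
    case False
    then show ?thesis using Cons by simp
  qed
qed simp

lemma periodic_iff: "periodic a f \<longleftrightarrow> (\<forall>x. f (x + a) = f x)"
  by (auto simp: periodic_def Delta_def fun_eq_iff)

lemma periodic_0 [simp]: "periodic 0 f"
  by (simp add: periodic_iff)

lemma periodic_sum: "(\<And>i. i \<in> I \<Longrightarrow> periodic a (g i)) \<Longrightarrow> periodic a (\<lambda>x. \<Sum>i\<in>I. g i x)"
  by (simp add: periodic_iff)

section \<open>Integer multiples and least common multiples\<close>

lemma zmul_0_right: "zmul k 0 = 0"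
  by (simp add: zmul_def)

lemma zmul_eq_0_iff:
  fixes x :: "'a::ab_group_add"
  assumes "torsion_free TYPE('a)"
  shows "zmul k x = 0 \<longleftrightarrow> k = 0 \<or> x = 0"
proof
  assume *: "zmul k x = 0"
  show "k = 0 \<or> x = 0"
  proof (cases k "0::int" rule: linorder_cases)
    case less
    then have "(\<Sum>i<nat (- k). x) = 0" "nat (- k) > 0" using * by (simp_all add: zmul_def)
    then show ?thesis using assms unfolding torsion_free_def by blast
  next
    case greater
    then have "(\<Sum>i<nat k. x) = 0" "nat k > 0" using * by (simp_all add: zmul_def)
    then show ?thesis using assms unfolding torsion_free_def by blast
  qed simp
qed (auto simp: zmul_0_right)

lemma periodic_zmul_eq:
  assumes "periodic c f"
  shows "f (x + zmul k c) = f x"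
proof (induction k rule: int_induct[where k = 0])
  case (step1 i)
  then show ?case
    using assms by (simp add: periodic_iff zmul_add add.assoc[symmetric])
next
  case (step2 i)
  have "f (x + zmul (i - 1) c) = f (x + zmul (i - 1) c + c)"
    using assms by (simp add: periodic_iff)
  also have "\<dots> = f (x + zmul i c)" by (simp add: zmul_diff add.assoc)
  finally show ?case using step2 by simp
qed simp

lemma periodic_zmul: "periodic c f \<Longrightarrow> periodic (zmul k c) f"
  by (simp add: periodic_iff[of "zmul k c"] periodic_zmul_eq)

lemma periodic_minus: "periodic c f \<Longrightarrow> periodic (- c) f"
  using periodic_zmul[of c f "- 1"] by (simp add: zmul_minus)

lemma is_lcm_single: "is_lcm {c} c"
  by (simp add: is_lcm_def)

lemma is_lcm_zmul:
  assumes "is_lcm B b" "c \<in> B"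
  obtains k where "b = zmul k c"
proof -
  have "b \<in> group_closure {b}" by (simp add: group_closure.base)
  then have "b \<in> group_closure {c}" using assms by (auto simp: is_lcm_def)
  then show ?thesis using that by (auto simp: group_closure_single)
qed

section \<open>Solving the difference equation among periodic functions\<close>

lemma int_primitive_exists:
  fixes \<phi> :: "int \<Rightarrow> real"
  shows "\<exists>\<Phi>. \<forall>k. \<Phi> (k + 1) - \<Phi> k = \<phi> k"
proof (intro exI allI)
  fix k :: int
  \<comment> \<open>The witness is the signed sum of \<open>\<phi>\<close> from 0 to
    \<open>k\<close>; one of its two intervals is always empty.\<close>
  show "((\<Sum>i\<in>{0..<k + 1}. \<phi> i) - (\<Sum>i\<in>{k + 1..<0}. \<phi> i))
          - ((\<Sum>i\<in>{0..<k}. \<phi> i) - (\<Sum>i\<in>{k..<0}. \<phi> i)) = \<phi> k"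
  proof (cases "k \<ge> 0")
    case True
    then have "{0..<k + 1} = insert k {0..<k}" by auto
    with True show ?thesis by simp
  next
    case False
    then have "{k..<0} = insert k {k + 1..<0}" by auto
    with False show ?thesis by simp
  qed
qed

text \<open>Fix a representative in each coset of the subgroup generated by \<open>b\<close> and
  \<open>c\<close>. By \<open>indep\<close> the coefficient \<open>K x\<close> of \<open>b\<close>
  in \<open>x\<close> is well defined, and moving by \<open>c\<close> does not change it. Hence a
  primitive of \<open>h\<close> in the direction of \<open>b\<close>, read off at
  \<open>K x\<close>, is \<open>c\<close>-periodic.\<close>

lemma periodic_Delta_solvable:
  fixes b c :: "'a::ab_group_add"
  assumes indep: "\<And>k l. zmul k b = zmul l c \<Longrightarrow> k = 0"
    and h: "periodic c h"
  shows "\<exists>g. periodic c g \<and> Delta b g = h"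
proof -
  define R where "R x y \<longleftrightarrow> (\<exists>k l. x = y + zmul k b + zmul l c)" for x y
  define r where "r x = (SOME y. R x y)" for x
  define K where "K x = (THE k. \<exists>l. x = r x + zmul k b + zmul l c)" for x
  have "R x x" for x
    unfolding R_def by (intro exI[of _ 0]) simp
  then have R_r: "R x (r x)" for x unfolding r_def by (rule someI)
  have K_eq: "K x = k" if "x = r x + zmul k b + zmul l c" for x k l
    unfolding K_def
  proof (rule the_equality)
    fix k' assume "\<exists>l. x = r x + zmul k' b + zmul l c"
    then obtain l' where "x = r x + zmul k' b + zmul l' c" by blast
    then have "r x + zmul k' b + zmul l' c = r x + zmul k b + zmul l c"
      using that by simp
    then have "zmul (k' - k) b = zmul (l - l') c"
      by (simp add: zmul_diff algebra_simps)
    then show "k' = k" using indep by fastforce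
  qed (use that in blast)
  have K: "\<exists>l. x = r x + zmul (K x) b + zmul l c" for x
    using R_r[of x] K_eq unfolding R_def by metis
  have r_shift: "r (x + zmul i b + zmul j c) = r x" for x i j
  proof -
    \<comment> \<open>\<open>SOME\<close> sees \<open>x\<close> only through the predicate
      \<open>R x\<close>, so equal predicates yield the same representative.\<close>
    have "R (x + zmul i b + zmul j c) y \<longleftrightarrow> R x y" for y
    proof
      assume "R (x + zmul i b + zmul j c) y"
      then obtain k l where "x + zmul i b + zmul j c = y + zmul k b + zmul l c"
        unfolding R_def by blast
      then have "x = y + zmul (k - i) b + zmul (l - j) c"
        by (simp add: zmul_diff algebra_simps)
      then show "R x y" unfolding R_def by blast
    next
      assume "R x y"
      then obtain k l where "x = y + zmul k b + zmul l c"
        unfolding R_def by blast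
      then have "x + zmul i b + zmul j c = y + zmul (k + i) b + zmul (l + j) c"
        by (simp add: zmul_add algebra_simps)
      then show "R (x + zmul i b + zmul j c) y" unfolding R_def by blast
    qed
    then show ?thesis by (simp add: r_def)
  qed
  have K_shift: "K (x + zmul i b + zmul j c) = K x + i" for x i j
  proof -
    obtain l where "x = r x + zmul (K x) b + zmul l c" using K by blast
    then have "x + zmul i b + zmul j c
        = r (x + zmul i b + zmul j c) + zmul (K x + i) b + zmul (l + j) c"
      unfolding r_shift by (simp add: zmul_add algebra_simps)
    then show ?thesis by (rule K_eq)
  qed
  have "\<exists>\<Phi>. \<forall>k. \<Phi> (k + 1) - \<Phi> k = h (y + zmul k b)" for y
    by (rule int_primitive_exists)
  then obtain \<Phi> where \<Phi>: "\<Phi> y (k + 1) - \<Phi> y k = h (y + zmul k b)" for y k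
    by metis
  define g where "g x = \<Phi> (r x) (K x)" for x
  have "g (x + c) = g x" for x
    using r_shift[of x 0 1] K_shift[of x 0 1] by (simp add: g_def)
  moreover have "g (x + b) - g x = h x" for x
  proof -
    obtain l where l: "x = r x + zmul (K x) b + zmul l c" using K by blast
    have "g (x + b) - g x = h (r x + zmul (K x) b)"
      using r_shift[of x 1 0] K_shift[of x 1 0] by (simp add: g_def \<Phi>)
    also have "\<dots> = h (r x + zmul (K x) b + zmul l c)"
      using periodic_zmul_eq[OF h] by simp
    finally show ?thesis using l by simp
  qed
  ultimately show ?thesis
    by (intro exI[of _ g]) (simp add: periodic_iff Delta_def)
qed

section \<open>Averages over finite orbits\<close>

text \<open>A combination of translations, hence commuting with every \<open>Delta a\<close>. On
  functions periodic under \<open>zmul (int m) c\<close> with \<open>m > 0\<close> it is the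
  projection \<open>P\<^sub>c\<close> onto the \<open>c\<close>-periodic ones.\<close>

definition avg :: "nat \<Rightarrow> 'a::ab_group_add \<Rightarrow> ('a \<Rightarrow> real) \<Rightarrow> 'a \<Rightarrow> real" where
  "avg m c f = (\<lambda>x. (\<Sum>i<m. f (x + zmul (int i) c)) / real m)"

lemma avg_Delta: "avg m c (Delta a f) = Delta a (avg m c f)"
  by (simp add: avg_def Delta_def sum_subtractf diff_divide_distrib add.assoc add.commute[of a])

lemma avg_foldr_Delta: "avg m c (foldr Delta bs f) = foldr Delta bs (avg m c f)"
  by (induction bs) (simp_all add: avg_Delta)

lemma avg_periodic: "periodic c f \<Longrightarrow> m > 0 \<Longrightarrow> avg m c f = f"
  by (simp add: avg_def periodic_zmul_eq)

lemma periodic_avg_preserves: "periodic b f \<Longrightarrow> periodic b (avg m c f)"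
  unfolding periodic_def avg_Delta[symmetric] by (simp add: avg_def)

text \<open>Translation by \<open>c\<close> trades the summand of index 0 for one of index
  \<open>m\<close>, and the hypothesis makes these equal.\<close>

lemma periodic_avg:
  assumes "periodic (zmul (int m) c) f"
  shows "periodic c (avg m c f)"
proof -
  have "(\<Sum>i<m. f (x + c + zmul (int i) c)) = (\<Sum>i<m. f (x + zmul (int i) c))" for x
  proof -
    define \<phi> where "\<phi> i = f (x + zmul (int i) c)" for i
    have "f (x + c + zmul (int i) c) = \<phi> (Suc i)" for i
      using zmul_Suc[of "int i" c] by (simp add: \<phi>_def add_ac)
    moreover have "(\<Sum>i<m. \<phi> (Suc i) - \<phi> i) = \<phi> m - \<phi> 0" by (rule sum_lessThan_telescope)
    moreover have "\<phi> m = \<phi> 0" using assms by (simp add: \<phi>_def periodic_iff)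
    ultimately show ?thesis by (simp add: sum_subtractf \<phi>_def)
  qed
  then show ?thesis by (simp add: periodic_iff avg_def)
qed

text \<open>Indexed by the set of periods, since both the partitions and the induction live on sets;
  \<open>decomposable_image_iff\<close> translates to families.\<close>

definition decomposable :: "'a::ab_group_add set \<Rightarrow> ('a \<Rightarrow> real) \<Rightarrow> bool" where
  "decomposable S f \<longleftrightarrow> (\<exists>g. (\<forall>c\<in>S. periodic c (g c)) \<and> f = (\<lambda>x. \<Sum>c\<in>S. g c x))"

lemma decomposable_periodic:
  assumes "finite S" "c \<in> S" "periodic c f"
  shows "decomposable S f"
  unfolding decomposable_def
  by (rule exI[of _ "\<lambda>d. if d = c then f else (\<lambda>_. 0)"])
    (use assms in \<open>auto simp: fun_eq_iff periodic_iff if_distrib[of "\<lambda>g. g _"] cong: if_cong\<close>)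

lemma decomposable_add:
  assumes "decomposable S f" "decomposable S g"
  shows "decomposable S (\<lambda>x. f x + g x)"
proof -
  obtain F G where "\<forall>c\<in>S. periodic c (F c)" "f = (\<lambda>x. \<Sum>c\<in>S. F c x)"
    and "\<forall>c\<in>S. periodic c (G c)" "g = (\<lambda>x. \<Sum>c\<in>S. G c x)"
    using assms unfolding decomposable_def by metis
  then show ?thesis unfolding decomposable_def
    by (intro exI[of _ "\<lambda>c x. F c x + G c x"]) (auto simp: periodic_iff sum.distrib)
qed

lemma decomposable_mono:
  assumes "decomposable S f" "S \<subseteq> T" "finite T"
  shows "decomposable T f"
proof -
  obtain g where g: "\<forall>c\<in>S. periodic c (g c)" "f = (\<lambda>x. \<Sum>c\<in>S. g c x)"
    using assms(1) unfolding decomposable_def by metis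
  have "(\<Sum>c\<in>T. (if c \<in> S then g c else (\<lambda>_. 0)) x) = (\<Sum>c\<in>S. g c x)" for x
    using assms by (intro sum.mono_neutral_cong_right) auto
  then show ?thesis unfolding decomposable_def
    by (intro exI[of _ "\<lambda>c. if c \<in> S then g c else (\<lambda>_. 0)"]) (use g in \<open>auto simp: periodic_iff\<close>)
qed

text \<open>Here \<open>u\<close> arises from \<open>f\<close> by applying
  \<open>1 - P\<^sub>c\<close> for each \<open>c\<close> in \<open>cs\<close>, and \<open>v\<close>
  collects the averages split off. Whatever \<open>Delta c\<close> kills is fixed by
  \<open>P\<^sub>c\<close>, so passing from \<open>f\<close> to \<open>u\<close> absorbs the factors
  \<open>Delta c\<close>.\<close>

lemma commensurable_split:
  assumes "periodic b f" "\<And>c. c \<in> set cs \<Longrightarrow> \<exists>m. m \<noteq> 0 \<and> b = zmul m c"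
  shows "\<exists>u v. f = (\<lambda>x. u x + v x) \<and> decomposable (set cs) v \<and>
           (\<forall>bs. foldr Delta (cs @ bs) f = (\<lambda>_. 0) \<longrightarrow> foldr Delta bs u = (\<lambda>_. 0))"
  using assms
proof (induction cs arbitrary: f)
  case Nil
  show ?case
    by (rule exI[of _ f], rule exI[of _ "\<lambda>_. 0"]) (auto simp: decomposable_def)
next
  case (Cons c cs)
  obtain k where k: "k \<noteq> 0" "b = zmul k c" using Cons.prems(2)[of c] by auto
  \<comment> \<open>\<open>k\<close> may be negative, but \<open>f\<close> is periodic under
    \<open>- b\<close> as well.\<close>
  define m where "m = nat \<bar>k\<bar>"
  have m: "m > 0" using k by (simp add: m_def)
  have "zmul (int m) c = b \<or> zmul (int m) c = - b"
    using k by (auto simp: m_def abs_if zmul_minus)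
  then have "periodic (zmul (int m) c) f" using Cons.prems(1) periodic_minus by metis
  then have per: "periodic c (avg m c f)" by (rule periodic_avg)
  define F where "F = (\<lambda>x. f x - avg m c f x)"
  have "periodic b F" using Cons.prems(1) periodic_avg_preserves[OF Cons.prems(1), of m c]
    by (simp add: F_def periodic_iff)
  then obtain u v where uv: "F = (\<lambda>x. u x + v x)" "decomposable (set cs) v"
    "\<And>bs. foldr Delta (cs @ bs) F = (\<lambda>_. 0) \<Longrightarrow> foldr Delta bs u = (\<lambda>_. 0)"
    using Cons.IH[of F] Cons.prems(2) by auto
  have "foldr Delta bs u = (\<lambda>_. 0)" if "foldr Delta ((c # cs) @ bs) f = (\<lambda>_. 0)" for bs
  proof (rule uv(3))
    have "periodic c (foldr Delta (cs @ bs) f)"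
      using that by (simp add: periodic_def)
    then have "foldr Delta (cs @ bs) (avg m c f) = foldr Delta (cs @ bs) f"
      using avg_periodic[OF _ m] avg_foldr_Delta by metis
    then show "foldr Delta (cs @ bs) F = (\<lambda>_. 0)"
      unfolding F_def foldr_Delta_diff by simp
  qed
  moreover have "decomposable (set (c # cs)) (\<lambda>x. avg m c f x + v x)"
  proof (rule decomposable_add)
    show "decomposable (set (c # cs)) (avg m c f)"
      by (rule decomposable_periodic[OF _ _ per]) auto
    show "decomposable (set (c # cs)) v"
      by (rule decomposable_mono[OF uv(2)]) auto
  qed
  moreover have "f = (\<lambda>x. u x + (avg m c f x + v x))"
    using uv(1) by (auto simp: F_def fun_eq_iff algebra_simps)
  ultimately show ?case
    by (intro exI[of _ u] exI[of _ "\<lambda>x. avg m c f x + v x"]) blast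
qed

section \<open>The partition condition\<close>

text \<open>Listing the blocks lets \<open>bs\<close> pick a generator for each, with either sign;
  the order is immaterial because the operators commute.\<close>

definition lcm_condition :: "'a::ab_group_add set \<Rightarrow> ('a \<Rightarrow> real) \<Rightarrow> bool" where
  "lcm_condition S f \<longleftrightarrow> (\<forall>Bs bs. distinct Bs \<and> partition_on S (set Bs) \<and> list_all2 is_lcm Bs bs
     \<longrightarrow> foldr Delta bs f = (\<lambda>_. 0))"

text \<open>A \<open>c\<close>-periodic summand is periodic under the least common multiple of the
  block containing \<open>c\<close>, so the factor of that block kills it.\<close>

lemma decomposable_imp_lcm_condition:
  assumes "decomposable S f"
  shows "lcm_condition S f"
  unfolding lcm_condition_def
proof (intro allI impI, elim conjE)
  fix Bs bs
  assume part: "partition_on S (set Bs)" and lcm: "list_all2 is_lcm Bs bs"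
  obtain g where g: "\<forall>c\<in>S. periodic c (g c)" "f = (\<lambda>x. \<Sum>c\<in>S. g c x)"
    using assms unfolding decomposable_def by metis
  have "foldr Delta bs (g c) = (\<lambda>_. 0)" if c: "c \<in> S" for c
  proof -
    obtain B where "B \<in> set Bs" "c \<in> B" using part c by (auto simp: partition_on_def)
    then obtain b where "b \<in> set bs" "is_lcm B b"
      using lcm by (metis in_set_conv_nth list_all2_conv_all_nth)
    then show ?thesis
      using foldr_Delta_periodic is_lcm_zmul \<open>c \<in> B\<close> periodic_zmul g(1) c by metis
  qed
  then show "foldr Delta bs f = (\<lambda>_. 0)" by (simp add: g(2) foldr_Delta_sum)
qed

text \<open>Serves to pass from \<open>S\<close> to \<open>S'\<close>, with \<open>As\<close> either
  the single block \<open>C\<close> or all singletons of \<open>C\<close>.\<close>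

lemma lcm_condition_Un:
  assumes "lcm_condition S f" "S = C \<union> S'" "C \<inter> S' = {}"
    and "distinct As" "partition_on C (set As)" "list_all2 is_lcm As as"
    and "distinct Bs" "partition_on S' (set Bs)" "list_all2 is_lcm Bs bs"
  shows "foldr Delta (as @ bs) f = (\<lambda>_. 0)"
proof -
  have "\<Union>(set As) = C" "\<Union>(set Bs) = S'"
    using assms(5,8) by (simp_all add: partition_on_def)
  then have "partition_on S (set (As @ Bs))"
    using assms(2,3,5,8) disjoint_union[of "set As" "set Bs"] by (simp add: partition_on_def)
  moreover have "set As \<inter> set Bs = {}"
  proof (rule Int_emptyI)
    fix B assume B: "B \<in> set As" "B \<in> set Bs"
    then have "B \<subseteq> C \<inter> S'" using assms(5,8) by (auto simp: partition_on_def)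
    then show False using assms(3) B(1) partition_onD3[OF assms(5)] by simp
  qed
  then have "distinct (As @ Bs)" using assms by simp
  moreover have "list_all2 is_lcm (As @ Bs) (as @ bs)"
    using assms by (simp add: list_all2_appendI)
  ultimately show ?thesis using assms(1) unfolding lcm_condition_def by blast
qed

text \<open>The coefficients are multiplied up. For \<open>s \<noteq> 0\<close> in a torsion free
  group this gives a nonzero common multiple, so the least common multiple of \<open>C\<close> is
  not 0.\<close>

lemma common_zmul_exists:
  fixes s :: "'a::ab_group_add"
  assumes "finite C" "\<And>c. c \<in> C \<Longrightarrow> \<exists>k l. k \<noteq> 0 \<and> zmul k s = zmul l c"
  shows "\<exists>k. k \<noteq> 0 \<and> (\<forall>c\<in>C. \<exists>l. zmul k s = zmul l c)"
  using assms
proof (induction C rule: finite_induct)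
  case empty
  show ?case by (intro exI[of _ 1]) simp
next
  case (insert c C)
  then obtain k where k: "k \<noteq> 0" "\<forall>c\<in>C. \<exists>l. zmul k s = zmul l c" by auto
  obtain k' l' where k': "k' \<noteq> 0" "zmul k' s = zmul l' c" using insert.prems by blast
  have "zmul (k * k') s = zmul (k * l') c" using k' by (simp add: zmul_mult)
  moreover have "\<exists>l. zmul (k * k') s = zmul l d" if "d \<in> C" for d
    using k(2) that by (metis mult.commute zmul_mult)
  ultimately show ?case using k(1) k'(1) by (intro exI[of _ "k * k'"]) auto
qed

lemma lcm_condition_imp_decomposable:
  fixes S :: "'a::ab_group_add set"
  assumes "torsion_free TYPE('a)" "finite S" "lcm_condition S f"
  shows "decomposable S f"
  using assms(2,3)
proof (induction S arbitrary: f rule: finite_psubset_induct)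
  case (psubset S)
  consider "S = {}" | "0 \<in> S" | s where "s \<in> S" "0 \<notin> S" by blast
  then show ?case
  proof cases
    case 1
    \<comment> \<open>The partition without blocks forces \<open>f\<close> to be 0, which is the
      empty sum.\<close>
    then have "foldr Delta [] f = (\<lambda>_. 0)"
      using psubset.prems unfolding lcm_condition_def
      by (metis distinct.simps(1) list_all2_Nil partition_on_empty set_empty)
    then show ?thesis using 1 by (simp add: decomposable_def)
  next
    case 2
    then show ?thesis using decomposable_periodic psubset.hyps periodic_0 by blast
  next
    case 3
    define C where "C = {c \<in> S. \<exists>k l. k \<noteq> 0 \<and> zmul k s = zmul l c}"
    define S' where "S' = S - C"
    have "s \<in> C" using 3 unfolding C_def by (auto intro: exI[of _ 1])
    have S': "S' \<subset> S" "S = C \<union> S'" "C \<inter> S' = {}" using \<open>s \<in> C\<close> by (auto simp: S'_def C_def)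
    have fin: "finite C" "finite S'" using psubset.hyps by (auto simp: S'_def C_def)
    obtain b where b: "is_lcm C b" using is_lcm_exists \<open>s \<in> C\<close> by blast
    have "b \<noteq> 0"
    proof
      assume "b = 0"
      obtain k where k: "k \<noteq> 0" "\<forall>c\<in>C. \<exists>l. zmul k s = zmul l c"
        using common_zmul_exists[OF fin(1), of s] by (auto simp: C_def)
      then have "zmul k s \<in> (\<Inter>c\<in>C. group_closure {c})" by (auto simp: group_closure_single)
      then have "zmul k s \<in> group_closure {b}" using b by (simp add: is_lcm_def)
      then have "zmul k s = 0"
        using \<open>b = 0\<close> by (auto simp: group_closure_single zmul_0_right)
      then show False using 3 k by (auto simp: zmul_eq_0_iff[OF assms(1)])
    qed
    have b_mult: "\<exists>m. m \<noteq> 0 \<and> b = zmul m c" if "c \<in> C" for c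
      using is_lcm_zmul[OF b that] \<open>b \<noteq> 0\<close> by (metis zmul_0)
    \<comment> \<open>Nonzero multiples of \<open>b\<close> are nonzero multiples of
      \<open>s\<close>, so such a relation with \<open>k \<noteq> 0\<close> would put
      \<open>c\<close> into \<open>C\<close>.\<close>
    have indep: "k = 0" if "c \<in> S'" "zmul k b = zmul l c" for c k l
    proof (rule ccontr)
      assume "k \<noteq> 0"
      obtain m where m: "m \<noteq> 0" "b = zmul m s" using b_mult \<open>s \<in> C\<close> by blast
      have "zmul (k * m) s = zmul l c" using that m by (simp add: zmul_mult)
      moreover have "k * m \<noteq> 0" using m \<open>k \<noteq> 0\<close> by simp
      ultimately have "c \<in> C" using that(1) S'(1) unfolding C_def by blast
      then show False using that S' by blast
    qed
    have "partition_on C (set [C])"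
      using \<open>s \<in> C\<close> by (auto intro!: partition_onI simp: pairwise_def)
    then have "lcm_condition S' (Delta b f)"
      using lcm_condition_Un[OF psubset.prems S'(2,3), of "[C]" "[b]"] b
      by (auto simp: lcm_condition_def foldr_Delta_commute)
    then have "decomposable S' (Delta b f)" using psubset.IH S'(1) by blast
    then obtain h where h: "\<forall>c\<in>S'. periodic c (h c)" "Delta b f = (\<lambda>x. \<Sum>c\<in>S'. h c x)"
      unfolding decomposable_def by metis
    have "\<forall>c\<in>S'. \<exists>g. periodic c g \<and> Delta b g = h c"
      using periodic_Delta_solvable indep h(1) by metis
    then obtain g where g: "\<And>c. c \<in> S' \<Longrightarrow> periodic c (g c)" "\<And>c. c \<in> S' \<Longrightarrow> Delta b (g c) = h c"
      by metis
    define G where "G = (\<lambda>x. \<Sum>c\<in>S'. g c x)"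
    have G: "decomposable S' G" unfolding decomposable_def G_def using g(1) by blast
    have S_G: "decomposable S G" using decomposable_mono[OF G] S' psubset.hyps by blast
    define f' where "f' = (\<lambda>x. f x - G x)"
    have per: "periodic b f'"
      by (simp add: periodic_def f'_def Delta_diff G_def Delta_sum g(2) h(2))
    obtain cs where cs: "set cs = C" "distinct cs"
      using finite_distinct_list[OF fin(1)] by blast
    obtain u v where uv: "f' = (\<lambda>x. u x + v x)" "decomposable C v"
      "\<And>bs. foldr Delta (cs @ bs) f' = (\<lambda>_. 0) \<Longrightarrow> foldr Delta bs u = (\<lambda>_. 0)"
      using commensurable_split[OF per, of cs] b_mult unfolding cs(1) by blast
    \<comment> \<open>The condition is linear in the function, and \<open>G\<close> satisfies it by
      the easy direction.\<close>
    have f': "lcm_condition S f'"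
      using psubset.prems decomposable_imp_lcm_condition[OF S_G]
      unfolding lcm_condition_def f'_def foldr_Delta_diff by auto
    have "partition_on C (set (map (\<lambda>c. {c}) cs))"
      using cs by (auto intro!: partition_onI simp: pairwise_def disjnt_def)
    moreover have "distinct (map (\<lambda>c. {c}) cs)"
      using cs by (simp add: distinct_map)
    moreover have "list_all2 is_lcm (map (\<lambda>c. {c}) cs) cs"
      by (simp add: list_all2_conv_all_nth is_lcm_single)
    ultimately have "lcm_condition S' u"
      unfolding lcm_condition_def using lcm_condition_Un[OF f' S'(2,3)] uv(3) by blast
    then have "decomposable S' u" using psubset.IH S'(1) by blast
    then have "decomposable S u" "decomposable S v"
      using decomposable_mono uv(2) S' psubset.hyps by blast+
    then have "decomposable S (\<lambda>x. (u x + v x) + G x)"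
      using S_G by (intro decomposable_add)
    moreover have "f = (\<lambda>x. (u x + v x) + G x)"
      using uv(1) by (auto simp: f'_def fun_eq_iff algebra_simps)
    ultimately show ?thesis by metis
  qed
qed

text \<open>The family \<open>a\<close> may repeat values. One way, \<open>J\<close> keeps one index
  per value and the other indices get the zero function; the other way, summands with equal period
  are added up.\<close>

lemma decomposable_image_iff:
  assumes "finite I"
  shows "decomposable (a ` I) f \<longleftrightarrow>
    (\<exists>g. (\<forall>j\<in>I. periodic (a j) (g j)) \<and> f = (\<lambda>x. \<Sum>j\<in>I. g j x))"
proof
  assume "decomposable (a ` I) f"
  then obtain g where g: "\<forall>c\<in>a ` I. periodic c (g c)" "f = (\<lambda>x. \<Sum>c\<in>a ` I. g c x)"
    unfolding decomposable_def by metis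
  obtain J where J: "J \<subseteq> I" "inj_on a J" "a ` J = a ` I"
    by (metis subset_image_inj order_refl)
  define G where "G j = (if j \<in> J then g (a j) else (\<lambda>_. 0))" for j
  have "(\<Sum>j\<in>I. G j x) = (\<Sum>j\<in>J. g (a j) x)" for x
    using assms J by (intro sum.mono_neutral_cong_right) (auto simp: G_def)
  also have "\<dots> x = f x" for x
    unfolding g(2) J(3)[symmetric] using J(2) by (simp add: sum.reindex)
  finally have "f = (\<lambda>x. \<Sum>j\<in>I. G j x)" by auto
  moreover have "\<forall>j\<in>I. periodic (a j) (G j)" using g(1) by (auto simp: G_def periodic_iff)
  ultimately show "\<exists>g. (\<forall>j\<in>I. periodic (a j) (g j)) \<and> f = (\<lambda>x. \<Sum>j\<in>I. g j x)" by blast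
next
  assume "\<exists>g. (\<forall>j\<in>I. periodic (a j) (g j)) \<and> f = (\<lambda>x. \<Sum>j\<in>I. g j x)"
  then obtain g where g: "\<forall>j\<in>I. periodic (a j) (g j)" "f = (\<lambda>x. \<Sum>j\<in>I. g j x)" by blast
  show "decomposable (a ` I) f"
    unfolding decomposable_def
  proof (intro exI conjI ballI)
    show "periodic c (\<lambda>x. \<Sum>j\<in>{j \<in> I. a j = c}. g j x)" for c
      using g(1) by (intro periodic_sum) auto
    show "f = (\<lambda>x. \<Sum>c\<in>a ` I. \<Sum>j\<in>{j \<in> I. a j = c}. g j x)"
      unfolding g(2) by (intro ext sum.image_gen assms)
  qed
qed

theorem corollary2p7:
  fixes a :: "nat \<Rightarrow> 'a::ab_group_add" and n :: nat and f :: "'a \<Rightarrow> real"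
  assumes "torsion_free TYPE('a)"
  shows "(\<exists>g :: nat \<Rightarrow> 'a \<Rightarrow> real.
            (\<forall>j\<in>{1..n}. periodic (a j) (g j)) \<and> f = (\<lambda>x. \<Sum>j=1..n. g j x)) \<longleftrightarrow>
         (\<forall>Bs bs. distinct Bs \<and> partition_on (a ` {1..n}) (set Bs) \<and> list_all2 is_lcm Bs bs
            \<longrightarrow> foldr Delta bs f = (\<lambda>_. 0))"
  unfolding lcm_condition_def[symmetric] decomposable_image_iff[OF finite_atLeastAtMost, symmetric]
  using decomposable_imp_lcm_condition lcm_condition_imp_decomposable[OF assms] by blast

end
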